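(* Let $f:\mathbb{R}^{n_x}\times\mathbb{R}^{n_y}\to\mathbb{R}$ be continuously differentiable, such that for all $x\in\mathbb{R}^{n_x}$ the function $f(x,\cdot)$ is incave and decreasing at infinity, and for all $y\in\mathbb{R}^{n_y}$ the function $f(\cdot,y)$ is invex and increasing at infinity. Assume that the set $E$ of saddle points of $f$ is non-empty. Then the set $\underline{M}\cup\overline{M}$, the union of the set of minimax points and the set of maximin points of $f$, is connected.
   Context: A differentiable function $g:\mathbb{R}^n\to\mathbb{R}$ is invex if every stationary point of $g$ is a global minimum of $g$; $g$ is incave if $-g$ is invex. $g$ is increasing at infinity if for every $x$ there is a compact set $K$ with $g(z)>g(x)$ for all $z\notin K$; $g$ is decreasing at infinity if $-g$ is increasing at infinity. For the problem $\min_{x}\max_{y} f(x,y)$, a point $(x^*,y^* )\in\mathbb{R}^{n_x}\times\mathbb{R}^{n_y}$ is: - a minimax point if for all $(x,y)$: $f(x^*,y)\le f(x^*,y^* )\le\max_{y'}f(x,y')$; the set of minimax points is $\underline{M}$; - a maximin point if for all $(x,y)$: $\min_{x'}f(x',y)\le f(x^*,y^* )\le f(x,y^* )$; the set of maximin points is $\overline{M}$; - a saddle point (Nash equilibrium) if for all $(x,y)$: $f(x^*,y)\le f(x^*,y^* )\le f(x,y^* )$; the set of saddle points is $E=\underline{M}\cap\overline{M}$. *)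

theory Defs
  imports "HOL-Analysis.Analysis"
begin

definition continuously_differentiable ::
    "('a::real_normed_vector \<Rightarrow> 'b::real_normed_vector) \<Rightarrow> bool" where
  "continuously_differentiable f \<longleftrightarrow>
     (\<exists>f' :: 'a \<Rightarrow> 'a \<Rightarrow>\<^sub>L 'b.
        (\<forall>z. (f has_derivative blinfun_apply (f' z)) (at z)) \<and> continuous_on UNIV f')"

definition stationary_point :: "('a::real_normed_vector \<Rightarrow> real) \<Rightarrow> 'a \<Rightarrow> bool" where
  "stationary_point g x \<longleftrightarrow> (g has_derivative (\<lambda>_. 0)) (at x)"

definition invex :: "('a::real_normed_vector \<Rightarrow> real) \<Rightarrow> bool" where
  "invex g \<longleftrightarrow> g differentiable_on UNIV \<and>
     (\<forall>x. stationary_point g x \<longrightarrow> (\<forall>z. g x \<le> g z))"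

definition incave :: "('a::real_normed_vector \<Rightarrow> real) \<Rightarrow> bool" where
  "incave g \<longleftrightarrow> invex (\<lambda>x. - g x)"

definition increasing_at_infinity :: "('a::topological_space \<Rightarrow> real) \<Rightarrow> bool" where
  "increasing_at_infinity g \<longleftrightarrow> (\<forall>x. \<exists>K. compact K \<and> (\<forall>z. z \<notin> K \<longrightarrow> g z > g x))"

definition decreasing_at_infinity :: "('a::topological_space \<Rightarrow> real) \<Rightarrow> bool" where
  "decreasing_at_infinity g \<longleftrightarrow> increasing_at_infinity (\<lambda>x. - g x)"

(* The bounds by max over y' and min over x' are stated at a maximizer, respectively
   a minimizer; in particular the extremum is required to be attained. This avoids
   the unspecified value of a supremum or infimum of an unbounded set of reals. *)

definition minimax_points :: "('a \<times> 'b \<Rightarrow> real) \<Rightarrow> ('a \<times> 'b) set" where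
  "minimax_points f = {(xs, ys). \<forall>x y. f (xs, y) \<le> f (xs, ys) \<and>
     (\<exists>ym. is_arg_max (\<lambda>y'. f (x, y')) (\<lambda>_. True) ym \<and> f (xs, ys) \<le> f (x, ym))}"

definition maximin_points :: "('a \<times> 'b \<Rightarrow> real) \<Rightarrow> ('a \<times> 'b) set" where
  "maximin_points f = {(xs, ys). \<forall>x y.
     (\<exists>xm. is_arg_min (\<lambda>x'. f (x', y)) (\<lambda>_. True) xm \<and> f (xm, y) \<le> f (xs, ys)) \<and>
     f (xs, ys) \<le> f (x, ys)}"

definition saddle_points :: "('a \<times> 'b \<Rightarrow> real) \<Rightarrow> ('a \<times> 'b) set" where
  "saddle_points f = {(xs, ys). \<forall>x y. f (xs, y) \<le> f (xs, ys) \<and> f (xs, ys) \<le> f (x, ys)}"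

end

theory Submission
  imports Defs
begin

text \<open>The crux is a finite-dimensional mountain pass argument in the style of Courant: the minimizers
  of a coercive invex \<open>C\<^sup>1\<close> function \<open>g\<close> form a connected set. Given two minimizers \<open>a\<close> and \<open>b\<close>, let
  \<open>c\<close> be the infimum of the levels whose sublevel set connects them. By compactness \<open>c\<close> is attained
  by a connected set. If \<open>c\<close> exceeded the minimum, no point at level \<open>c\<close> would be stationary, so one
  short gradient step \<open>x \<mapsto> x - t \<nabla>g(x)\<close>, which fixes \<open>a\<close> and \<open>b\<close>, would push this connected set
  strictly below \<open>c\<close>.

  Now fix a saddle point \<open>(x\<^sub>0, y\<^sub>0)\<close>. A minimax point \<open>(x, y)\<close> is joined to \<open>(x, y\<^sub>0)\<close> within
  the connected set of maximizers of \<open>f(x, \<cdot>)\<close>, and \<open>(x, y\<^sub>0)\<close> is joined to \<open>(x\<^sub>0, y\<^sub>0)\<close> within the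
  connected set of minimizers of \<open>f(\<cdot>, y\<^sub>0)\<close>; maximin points are treated symmetrically.\<close>

section \<open>Compactness of sublevel sets and existence of minimizers\<close>

lemma increasing_at_infinity_compact_sublevel:
  fixes g :: "'a::t2_space \<Rightarrow> real"
  assumes "increasing_at_infinity g" "continuous_on UNIV g"
  shows "compact {z. g z \<le> g x}"
proof -
  obtain K where K: "compact K" "\<And>z. z \<notin> K \<Longrightarrow> g z > g x"
    using assms(1) unfolding increasing_at_infinity_def by blast
  have "closed {z. g z \<le> g x}"
    using closed_Collect_le[OF assms(2) continuous_on_const] .
  moreover have "K \<inter> {z. g z \<le> g x} = {z. g z \<le> g x}"
    using K(2) by fastforce
  ultimately show ?thesis
    using compact_Int_closed[OF K(1)] by metis
qed

lemma increasing_at_infinity_attains_min: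
  fixes g :: "'a::t2_space \<Rightarrow> real"
  assumes "increasing_at_infinity g" "continuous_on UNIV g"
  obtains x where "\<And>z. g x \<le> g z"
proof -
  fix x0 :: 'a
  have "compact {z. g z \<le> g x0}" "{z. g z \<le> g x0} \<noteq> {}"
    using increasing_at_infinity_compact_sublevel[OF assms] by auto
  then obtain x where "g x \<le> g x0" "\<And>z. g z \<le> g x0 \<Longrightarrow> g x \<le> g z"
    using continuous_attains_inf[of "{z. g z \<le> g x0}" g] continuous_on_subset[OF assms(2)] by auto
  then show thesis
    using that by (metis linear order_trans)
qed

section \<open>Mountain pass argument\<close>

text \<open>Compactness makes one step length work for all of \<open>S\<close>. If the lengths
  \<open>1 / Suc n\<close> all fail, the bad starting points accumulate at some \<open>x\<close> in
  \<open>S\<close> with \<open>g x = c\<close>, and passing to the limit in the mean value theorem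
  forces \<open>G x = 0\<close>.\<close>

lemma gradient_step_decreases:
  fixes g :: "'a::euclidean_space \<Rightarrow> real" and G :: "'a \<Rightarrow> 'a"
  assumes deriv: "\<And>x. (g has_derivative (\<lambda>h. G x \<bullet> h)) (at x)"
    and cont: "continuous_on UNIV G"
    and S: "compact S" "\<And>x. x \<in> S \<Longrightarrow> g x \<le> c"
    and nonzero: "\<And>x. x \<in> S \<Longrightarrow> g x = c \<Longrightarrow> G x \<noteq> 0"
  obtains t where "t > 0" "\<And>x. x \<in> S \<Longrightarrow> g (x - t *\<^sub>R G x) < c"
proof (rule ccontr)
  assume "\<not> thesis"
  then have "\<not> (\<exists>t>0. \<forall>x\<in>S. g (x - t *\<^sub>R G x) < c)"
    using that by blast
  then have "\<exists>x\<in>S. c \<le> g (x - t *\<^sub>R G x)" if "t > 0" for t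
    using that by (meson not_less)
  then have "\<forall>n. \<exists>x. x \<in> S \<and> c \<le> g (x - (1 / real (Suc n)) *\<^sub>R G x)"
    by (metis of_nat_0_less_iff zero_less_Suc zero_less_divide_1_iff)
  then obtain X where X: "\<And>n. X n \<in> S"
    "\<And>n. c \<le> g (X n - (1 / real (Suc n)) *\<^sub>R G (X n))"
    by metis
  obtain x r where x: "x \<in> S" and r: "strict_mono r" and lim: "(X \<circ> r) \<longlonglongrightarrow> x"
    using S(1) X(1) unfolding compact_def by blast
  define t where "t n = 1 / real (Suc (r n))" for n
  define Y where "Y n = X (r n)" for n
  have t0: "t \<longlonglongrightarrow> 0"
    using LIMSEQ_subseq_LIMSEQ[OF LIMSEQ_inverse_real_of_nat r]
    by (simp add: t_def[abs_def] o_def inverse_eq_divide)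
  have tpos: "t n > 0" for n by (simp add: t_def)
  have Y: "Y \<longlonglongrightarrow> x" using lim by (simp add: Y_def[abs_def] o_def)
  have isG: "isCont G z" for z
    using cont by (simp add: continuous_on_eq_continuous_at)
  have isg: "isCont g z" for z
    using deriv has_derivative_continuous by blast
  have GY: "(\<lambda>n. G (Y n)) \<longlonglongrightarrow> G x"
    using isCont_tendsto_compose[OF isG Y] .
  have step0: "(\<lambda>n. t n *\<^sub>R G (Y n)) \<longlonglongrightarrow> 0"
    using tendsto_scaleR[OF t0 GY] by simp
  have "(\<lambda>n. Y n - t n *\<^sub>R G (Y n)) \<longlonglongrightarrow> x"
    using tendsto_diff[OF Y step0] by simp
  then have "(\<lambda>n. g (Y n - t n *\<^sub>R G (Y n))) \<longlonglongrightarrow> g x"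
    by (rule isCont_tendsto_compose[OF isg])
  then have "c \<le> g x"
    by (rule LIMSEQ_le_const) (use X(2) in \<open>auto simp: Y_def t_def\<close>)
  then have gx: "g x = c" using S(2)[OF x] by simp
  \<comment> \<open>The failed step starts at level at most \<open>c\<close> and ends at level at
    least \<open>c\<close>. So the derivative of \<open>g\<close> along it, which is minus the inner
    product below, is nonnegative at some intermediate \<open>s\<close>.\<close>
  have "\<exists>s. 0 < s \<and> s < t n \<and> G (Y n - s *\<^sub>R G (Y n)) \<bullet> G (Y n) \<le> 0" for n
  proof -
    let ?p = "\<lambda>s. g (Y n - s *\<^sub>R G (Y n))"
    have der: "(?p has_real_derivative - (G (Y n - s *\<^sub>R G (Y n)) \<bullet> G (Y n))) (at s)" for s
    proof -
      have "((\<lambda>s. Y n - s *\<^sub>R G (Y n)) has_derivative (\<lambda>h. - (h *\<^sub>R G (Y n)))) (at s)"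
        by (auto intro!: derivative_eq_intros)
      then show ?thesis
        unfolding has_field_derivative_def
        by (rule has_derivative_eq_rhs[OF has_derivative_compose[OF _ deriv]])
           (simp add: fun_eq_iff)
    qed
    obtain s where s: "0 < s" "s < t n"
      "?p (t n) - ?p 0 = (t n - 0) * - (G (Y n - s *\<^sub>R G (Y n)) \<bullet> G (Y n))"
      using MVT2[OF tpos der] by blast
    have "?p (t n) - ?p 0 \<ge> 0"
      using X(2)[of "r n"] S(2)[OF X(1)[of "r n"]] by (simp add: Y_def t_def)
    then have "t n * (G (Y n - s *\<^sub>R G (Y n)) \<bullet> G (Y n)) \<le> 0"
      using s(3) by simp
    then have "G (Y n - s *\<^sub>R G (Y n)) \<bullet> G (Y n) \<le> 0"
      using tpos[of n] by (simp add: mult_le_0_iff)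
    with s show ?thesis by blast
  qed
  then obtain s where s: "\<And>n. 0 < s n" "\<And>n. s n < t n"
    "\<And>n. G (Y n - s n *\<^sub>R G (Y n)) \<bullet> G (Y n) \<le> 0"
    by metis
  have s0: "s \<longlonglongrightarrow> 0"
    by (rule tendsto_sandwich[OF _ _ tendsto_const t0])
       (use s in \<open>auto intro!: always_eventually less_imp_le\<close>)
  have "(\<lambda>n. Y n - s n *\<^sub>R G (Y n)) \<longlonglongrightarrow> x"
    using tendsto_diff[OF Y tendsto_scaleR[OF s0 GY]] by simp
  then have "(\<lambda>n. G (Y n - s n *\<^sub>R G (Y n)) \<bullet> G (Y n)) \<longlonglongrightarrow> G x \<bullet> G x"
    by (intro tendsto_inner GY isCont_tendsto_compose[OF isG])
  then have "G x \<bullet> G x \<le> 0"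
    by (rule LIMSEQ_le_const2) (use s(3) in auto)
  then show False using nonzero[OF x gx] by (simp flip: inner_gt_zero_iff)
qed

lemma connected_minimizers:
  fixes g :: "'a::euclidean_space \<Rightarrow> real" and G :: "'a \<Rightarrow> 'a"
  assumes deriv: "\<And>x. (g has_derivative (\<lambda>h. G x \<bullet> h)) (at x)"
    and cont: "continuous_on UNIV G"
    and inv: "invex g" and inc: "increasing_at_infinity g"
  shows "connected {x. \<forall>z. g x \<le> g z}" (is "connected ?S")
  unfolding connected_iff_connected_component
proof (intro ballI)
  fix a b assume a: "a \<in> ?S" and b: "b \<in> ?S"
  have contg: "continuous_on UNIV g"
    using deriv by (meson has_derivative_continuous continuous_at_imp_continuous_on)
  have min0: "G x = 0" if "x \<in> ?S" for x
  proof -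
    have "(\<lambda>h. G x \<bullet> h) = (\<lambda>h. 0)"
      by (rule differential_zero_maxmin[OF _ open_UNIV deriv]) (use that in auto)
    then show ?thesis by (metis inner_eq_zero_iff)
  qed
  have stat: "x \<in> ?S" if "G x = 0" for x
    using deriv[of x] inv that by (simp add: invex_def stationary_point_def)
  define P where "P = {c. connected_component {x. g x \<le> c} a b}"
  define C where "C c = connected_component_set {x. g x \<le> c} a" for c
  \<comment> \<open>The highest point of the segment gives a level \<open>g p\<close> in
    \<open>P\<close>.\<close>
  obtain p where p: "\<And>z. z \<in> closed_segment a b \<Longrightarrow> g z \<le> g p"
    using continuous_attains_sup[of "closed_segment a b" g] continuous_on_subset[OF contg]
    by (metis compact_segment ends_in_segment(1) empty_iff subset_UNIV)
  have pP: "g p \<in> P"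
    using p unfolding P_def connected_component_def
    by (intro CollectI exI[of _ "closed_segment a b"]) auto
  have Plow: "g a \<le> c" if "c \<in> P" for c
    using that connected_component_in unfolding P_def by fastforce
  have bdd: "bdd_below P" using Plow by (rule bdd_belowI)
  \<comment> \<open>Being increasing at infinity makes a sublevel set compact only when its level is
    bounded by a value of \<open>g\<close>, since \<open>g\<close> itself may be bounded. Cutting
    off at \<open>g p\<close> makes \<open>T\<close> the intersection of a chain of compact
    connected sets, hence connected.\<close>
  define T where "T = \<Inter> (C ` (P \<inter> {..g p}))"
  have comp: "compact {x. g x \<le> c}" if "c \<le> g p" for c
  proof -
    have "{x. g x \<le> c} = {x. g x \<le> g p} \<inter> {x. g x \<le> c}" using that by auto
    moreover have "closed {x. g x \<le> c}"
      using closed_Collect_le[OF contg continuous_on_const] .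
    ultimately show ?thesis
      using compact_Int_closed[OF increasing_at_infinity_compact_sublevel[OF inc contg, of p]]
      by metis
  qed
  have compC: "compact (C c)" if "c \<le> g p" for c
    unfolding C_def by (rule closedin_compact[OF comp[OF that] closedin_connected_component])
  have "connected T"
    unfolding T_def
  proof (rule connected_chain)
    show "compact S \<and> connected S" if "S \<in> C ` (P \<inter> {..g p})" for S
      using that compC by (auto simp: C_def)
    have "C c \<subseteq> C d" if "c \<le> d" for c d
      unfolding C_def by (rule connected_component_mono) (use that in auto)
    then show "S \<subseteq> S' \<or> S' \<subseteq> S" if "S \<in> C ` (P \<inter> {..g p}) \<and> S' \<in> C ` (P \<inter> {..g p})" for S S'
      using that by (elim conjE imageE) (metis linear)
  qed
  have "compact T"
    unfolding T_def using compC pP by (intro compact_Inter) auto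
  have aT: "a \<in> T"
    unfolding T_def C_def using Plow by auto
  have bT: "b \<in> T"
    unfolding T_def C_def P_def by auto
  have Tle: "g x \<le> Inf P" if "x \<in> T" for x
  proof (rule cInf_greatest)
    show "P \<noteq> {}" using pP by blast
    fix c assume "c \<in> P"
    \<comment> \<open>Levels of \<open>P\<close> above the cutoff are replaced by
      \<open>g p\<close>, which lies in \<open>P\<close> as well.\<close>
    then have "min c (g p) \<in> P \<inter> {..g p}" using pP by (auto simp: min_def)
    then have "x \<in> C (min c (g p))" using that unfolding T_def by blast
    then have "g x \<le> min c (g p)"
      unfolding C_def using connected_component_in by fastforce
    then show "g x \<le> c" by simp
  qed
  have "Inf P \<le> g a"
  proof (rule ccontr)
    assume above: "\<not> Inf P \<le> g a"
    have "G x \<noteq> 0" if "g x = Inf P" for x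
      using that stat[of x] above by auto
    then obtain t where t: "t > 0" "\<And>x. x \<in> T \<Longrightarrow> g (x - t *\<^sub>R G x) < Inf P"
      using gradient_step_decreases[OF deriv cont \<open>compact T\<close> Tle] by metis
    \<comment> \<open>The image of \<open>T\<close> under the step is connected and contains
      \<open>a\<close> and \<open>b\<close>, where the gradient vanishes. By compactness its highest
      value \<open>g q\<close> is attained, so \<open>g q\<close> is an element of \<open>P\<close>
      below \<open>Inf P\<close>.\<close>
    let ?h = "\<lambda>x. x - t *\<^sub>R G x"
    have conth: "continuous_on T ?h"
      using continuous_on_subset[OF cont] by (intro continuous_intros) auto
    obtain q where q: "q \<in> ?h ` T" "\<And>z. z \<in> ?h ` T \<Longrightarrow> g z \<le> g q"
      using continuous_attains_sup[OF compact_continuous_image[OF conth \<open>compact T\<close>], of g]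
        continuous_on_subset[OF contg] aT by blast
    have "a \<in> ?h ` T" "b \<in> ?h ` T"
      using aT bT min0[OF a] min0[OF b] by force+
    then have "g q \<in> P"
      using connected_continuous_image[OF conth \<open>connected T\<close>] q(2)
      unfolding P_def connected_component_def by blast
    then have "Inf P \<le> g q" using bdd by (rule cInf_lower)
    then show False using q(1) t(2) by fastforce
  qed
  then have "T \<subseteq> ?S"
    using a by (auto dest!: Tle intro: order_trans[OF order_trans])
  then show "connected_component ?S a b"
    using \<open>connected T\<close> aT bT unfolding connected_component_def by blast
qed

section \<open>Gradients and restriction to slices\<close>

lemma continuously_differentiable_gradient:
  fixes g :: "'a::euclidean_space \<Rightarrow> real"
  assumes "continuously_differentiable g"
  obtains G where "\<And>x. (g has_derivative (\<lambda>h. G x \<bullet> h)) (at x)" "continuous_on UNIV G"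
proof -
  obtain g' :: "'a \<Rightarrow> 'a \<Rightarrow>\<^sub>L real" where
    g': "\<And>z. (g has_derivative blinfun_apply (g' z)) (at z)" "continuous_on UNIV g'"
    using assms unfolding continuously_differentiable_def by blast
  \<comment> \<open>The Riesz representative of the derivative, written in the orthonormal basis so
    that continuity can be read off its coordinates.\<close>
  define G where "G x = (\<Sum>b\<in>Basis. g' x b *\<^sub>R b)" for x
  have "blinfun_apply (g' x) = (\<lambda>h. G x \<bullet> h)" for x
  proof
    fix h
    have "g' x h = g' x (\<Sum>b\<in>Basis. (b \<bullet> h) *\<^sub>R b)"
      unfolding inner_commute[of _ h] by (simp add: euclidean_representation)
    also have "\<dots> = G x \<bullet> h"
      by (simp add: G_def blinfun.sum_right blinfun.scaleR_right inner_sum_left mult.commute)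
    finally show "g' x h = G x \<bullet> h" .
  qed
  then have "(g has_derivative (\<lambda>h. G x \<bullet> h)) (at x)" for x
    using g'(1)[of x] by simp
  moreover have "continuous_on UNIV G"
    unfolding G_def[abs_def] by (intro continuous_intros g'(2))
  ultimately show thesis by (rule that)
qed

lemma continuously_differentiable_continuous_on:
  assumes "continuously_differentiable g"
  shows "continuous_on UNIV g"
  using assms has_derivative_continuous continuous_at_imp_continuous_on
  unfolding continuously_differentiable_def by blast

text \<open>Used for the slice embeddings of the two factors into the product. As \<open>p\<close>
  has the same derivative \<open>L\<close> everywhere, the derivative of the composite varies only
  through \<open>f' (p x)\<close>.\<close>

lemma continuously_differentiable_compose_affine:
  assumes "continuously_differentiable f"
    and p: "\<And>x. (p has_derivative L) (at x)"
  shows "continuously_differentiable (\<lambda>x. f (p x))"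
proof -
  obtain f' where f': "\<And>z. (f has_derivative blinfun_apply (f' z)) (at z)" "continuous_on UNIV f'"
    using assms(1) unfolding continuously_differentiable_def by blast
  have L: "bounded_linear L" using p by (rule has_derivative_bounded_linear)
  define F where "F x = f' (p x) o\<^sub>L Blinfun L" for x
  have "((\<lambda>x. f (p x)) has_derivative blinfun_apply (F x)) (at x)" for x
    by (rule has_derivative_eq_rhs[OF has_derivative_compose[OF p f'(1)]])
       (simp add: F_def fun_eq_iff bounded_linear_Blinfun_apply[OF L])
  moreover have "continuous_on UNIV p"
    using p has_derivative_continuous continuous_at_imp_continuous_on by blast
  then have "continuous_on UNIV F"
    unfolding F_def[abs_def]
    by (intro continuous_intros continuous_on_compose2[OF f'(2)]) auto
  ultimately show ?thesis
    unfolding continuously_differentiable_def by blast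
qed

lemma continuously_differentiable_uminus:
  assumes "continuously_differentiable g"
  shows "continuously_differentiable (\<lambda>x. - g x)"
proof -
  obtain g' where g': "\<And>z. (g has_derivative blinfun_apply (g' z)) (at z)" "continuous_on UNIV g'"
    using assms unfolding continuously_differentiable_def by blast
  have "((\<lambda>x. - g x) has_derivative blinfun_apply (- g' z)) (at z)" for z
    by (rule has_derivative_eq_rhs[OF has_derivative_minus[OF g'(1)]])
       (simp add: fun_eq_iff blinfun.minus_left)
  moreover have "continuous_on UNIV (\<lambda>z. - g' z)"
    by (intro continuous_intros g'(2))
  ultimately show ?thesis
    unfolding continuously_differentiable_def by (intro exI[of _ "\<lambda>z. - g' z"]) simp
qed

section \<open>Joining minimax and maximin points to a saddle point\<close>

theorem proposition2:
  fixes f :: "(real ^ 'nx) \<times> (real ^ 'ny) \<Rightarrow> real"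
  assumes "continuously_differentiable f"
    and "\<And>x. incave (\<lambda>y. f (x, y))"
    and "\<And>x. decreasing_at_infinity (\<lambda>y. f (x, y))"
    and "\<And>y. invex (\<lambda>x. f (x, y))"
    and "\<And>y. increasing_at_infinity (\<lambda>x. f (x, y))"
    and "saddle_points f \<noteq> {}"
  shows "connected (minimax_points f \<union> maximin_points f)"
proof -
  let ?U = "minimax_points f \<union> maximin_points f"
  let ?A = "\<lambda>x. {y. \<forall>y'. f (x, y') \<le> f (x, y)}"
  let ?B = "\<lambda>y. {x. \<forall>x'. f (x, y) \<le> f (x', y)}"
  have dx: "continuously_differentiable (\<lambda>x. f (x, y))" for y
    by (rule continuously_differentiable_compose_affine[OF assms(1)]) (rule derivative_intros)+
  have dy: "continuously_differentiable (\<lambda>y. - f (x, y))" for x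
    by (intro continuously_differentiable_uminus continuously_differentiable_compose_affine[OF assms(1)])
       (rule derivative_intros)+
  have conA: "connected (?A x)" for x
  proof -
    obtain G where "\<And>y. ((\<lambda>y. - f (x, y)) has_derivative (\<lambda>h. G y \<bullet> h)) (at y)"
      "continuous_on UNIV G"
      using continuously_differentiable_gradient[OF dy] by blast
    from connected_minimizers[OF this] assms(2,3)[of x] show ?thesis
      by (simp add: incave_def decreasing_at_infinity_def)
  qed
  have conB: "connected (?B y)" for y
  proof -
    obtain G where "\<And>x. ((\<lambda>x. f (x, y)) has_derivative (\<lambda>h. G x \<bullet> h)) (at x)"
      "continuous_on UNIV G"
      using continuously_differentiable_gradient[OF dx] by blast
    from connected_minimizers[OF this assms(4,5)] show ?thesis .
  qed
  \<comment> \<open>Attained extrema provide the \<open>is_arg_max\<close> and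
    \<open>is_arg_min\<close> witnesses that the definitions demand.\<close>
  have maxA: "\<exists>y. \<forall>y'. f (x, y') \<le> f (x, y)" for x
    using increasing_at_infinity_attains_min[OF _ continuously_differentiable_continuous_on[OF dy]]
      assms(3)[of x] unfolding decreasing_at_infinity_def by (metis neg_le_iff_le)
  have minB: "\<exists>x. \<forall>x'. f (x, y) \<le> f (x', y)" for y
    using increasing_at_infinity_attains_min[OF assms(5) continuously_differentiable_continuous_on[OF dx]]
    by metis
  obtain x0 y0 where s: "\<And>y. f (x0, y) \<le> f (x0, y0)" "\<And>x. f (x0, y0) \<le> f (x, y0)"
    using assms(6) unfolding saddle_points_def by auto
  let ?v = "f (x0, y0)"
  \<comment> \<open>The saddle value \<open>?v\<close> is the minimax value: the maximum of
    \<open>f (x, \<cdot>)\<close> is at least \<open>f (x, y0)\<close>, hence at least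
    \<open>?v\<close>, and for \<open>x0\<close> it equals \<open>?v\<close>.\<close>
  have minimax: "(x, y) \<in> minimax_points f \<longleftrightarrow> y \<in> ?A x \<and> f (x, y) = ?v" for x y
  proof
    assume "(x, y) \<in> minimax_points f"
    then have 1: "y \<in> ?A x" and "\<exists>ym. f (x, y) \<le> f (x0, ym)"
      unfolding minimax_points_def by auto
    then have "f (x, y) \<le> ?v" using s(1) order_trans by blast
    moreover have "?v \<le> f (x, y)" using 1 s(2)[of x] order_trans by blast
    ultimately show "y \<in> ?A x \<and> f (x, y) = ?v" using 1 by auto
  next
    assume 1: "y \<in> ?A x \<and> f (x, y) = ?v"
    have "\<exists>ym. is_arg_max (\<lambda>y'. f (x', y')) (\<lambda>_. True) ym \<and> ?v \<le> f (x', ym)" for x'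
      using maxA[of x'] s(2)[of x'] unfolding is_arg_max_def by (meson not_less order_trans)
    then show "(x, y) \<in> minimax_points f"
      using 1 unfolding minimax_points_def by auto
  qed
  have maximin: "(x, y) \<in> maximin_points f \<longleftrightarrow> x \<in> ?B y \<and> f (x, y) = ?v" for x y
  proof
    assume "(x, y) \<in> maximin_points f"
    then have 1: "x \<in> ?B y" and "\<exists>xm. f (xm, y0) \<le> f (x, y)"
      unfolding maximin_points_def by auto
    then have "?v \<le> f (x, y)" using s(2) order_trans by blast
    moreover have "f (x, y) \<le> ?v" using 1 s(1)[of y] order_trans by blast
    ultimately show "x \<in> ?B y \<and> f (x, y) = ?v" using 1 by auto
  next
    assume 1: "x \<in> ?B y \<and> f (x, y) = ?v"
    have "\<exists>xm. is_arg_min (\<lambda>x'. f (x', y')) (\<lambda>_. True) xm \<and> f (xm, y') \<le> ?v" for y'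
      using minB[of y'] s(1)[of y'] unfolding is_arg_min_def by (meson not_less order_trans)
    then show "(x, y) \<in> maximin_points f"
      using 1 unfolding maximin_points_def by auto
  qed
  \<comment> \<open>If the maximum of \<open>f (x, \<cdot>)\<close> is \<open>?v\<close>, every
    maximizer yields a minimax point, so the whole connected slice stays inside
    \<open>?U\<close>.\<close>
  have joinA: "connected_component ?U (x, y) (x, y')"
    if "y \<in> ?A x" "y' \<in> ?A x" "f (x, y) = ?v" for x y y'
    unfolding connected_component_def
  proof (intro exI conjI)
    show "connected ({x} \<times> ?A x)" by (intro connected_Times conA) simp
    have "f (x, z) = ?v" if "z \<in> ?A x" for z
      using that \<open>y \<in> ?A x\<close> \<open>f (x, y) = ?v\<close> by (metis (mono_tags, lifting) mem_Collect_eq order_antisym)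
    then show "{x} \<times> ?A x \<subseteq> ?U" using minimax by auto
  qed (use that in auto)
  have joinB: "connected_component ?U (x, y) (x', y)"
    if "x \<in> ?B y" "x' \<in> ?B y" "f (x, y) = ?v" for x x' y
    unfolding connected_component_def
  proof (intro exI conjI)
    show "connected (?B y \<times> {y})" by (intro connected_Times conB) simp
    have "f (z, y) = ?v" if "z \<in> ?B y" for z
      using that \<open>x \<in> ?B y\<close> \<open>f (x, y) = ?v\<close> by (metis (mono_tags, lifting) mem_Collect_eq order_antisym)
    then show "?B y \<times> {y} \<subseteq> ?U" using maximin by auto
  qed (use that in auto)
  have "connected_component ?U z (x0, y0)" if "z \<in> ?U" for z
  proof -
    obtain x y where z: "z = (x, y)" by fastforce
    from that consider "(x, y) \<in> minimax_points f" | "(x, y) \<in> maximin_points f"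
      unfolding z by blast
    then show ?thesis
    proof cases
      case 1
      then have y: "y \<in> ?A x" "f (x, y) = ?v" using minimax by auto
      \<comment> \<open>The corner \<open>(x, y0)\<close> satisfies
        \<open>?v \<le> f (x, y0) \<le> f (x, y) = ?v\<close>. Hence \<open>y0\<close> maximizes
        \<open>f (x, \<cdot>)\<close> and \<open>x\<close> minimizes \<open>f (\<cdot>, y0)\<close>,
        so both slices pass through it.\<close>
      then have v: "f (x, y0) = ?v" using s(2)[of x] by (auto intro: order_antisym)
      have "connected_component ?U (x, y) (x, y0)"
        using y v by (intro joinA) auto
      moreover have "connected_component ?U (x, y0) (x0, y0)"
        using s(2) v by (intro joinB) auto
      ultimately show ?thesis unfolding z by (rule connected_component_trans)
    next
      case 2
      then have x: "x \<in> ?B y" "f (x, y) = ?v" using maximin by auto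
      then have v: "f (x0, y) = ?v" using s(1)[of y] by (auto intro: order_antisym)
      have "connected_component ?U (x, y) (x0, y)"
        using x v by (intro joinB) auto
      moreover have "connected_component ?U (x0, y) (x0, y0)"
        using s(1) v by (intro joinA) auto
      ultimately show ?thesis unfolding z by (rule connected_component_trans)
    qed
  qed
  then show ?thesis
    unfolding connected_iff_connected_component
    by (meson connected_component_sym connected_component_trans)
qed

end
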